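(* Let $n \in \mathbb{N}$ and suppose that $a_n = 3\cdot 2^{n-1}-1$, $b_n = 3\cdot 2^n-1$ and $m_n = 2^n-1$ are all prime. If $c_n = 9\cdot 2^{2n-1}-1$ is not prime, then $r_n = 2^n a_n b_n$ and $s_n = 2^n c_n$ are not amicable.
   Context: $\mathbb{N}=\{1,2,\dots\}$. For $k\in\mathbb{N}$, $\sigma(k)$ denotes the sum of the proper divisors (aliquot parts) of $k$, i.e. $\sigma(k)=\sum_{d\mid k,\ d<k} d$, the sum being over positive divisors $d$ of $k$ with $d<k$ (note that $k$ itself is excluded). Two positive integers $k,l$ are called amicable if $\sigma(k)=l$ and $\sigma(l)=k$. *)

theory Defs
  imports "HOL-Computational_Algebra.Primes"
begin

definition aliquot_sum :: "nat \<Rightarrow> nat" where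
  "aliquot_sum k = (\<Sum>d | d dvd k \<and> d < k. d)"

definition amicable :: "nat \<Rightarrow> nat \<Rightarrow> bool" where
  "amicable k l \<longleftrightarrow> 0 < k \<and> 0 < l \<and> aliquot_sum k = l \<and> aliquot_sum l = k"

(* Subtraction on nat truncates, but for n >= 1 it agrees with integer subtraction
   everywhere below: the exponents are nonnegative and the powers are positive. *)

definition a_seq :: "nat \<Rightarrow> nat" where
  "a_seq n = 3 * 2 ^ (n - 1) - 1"

definition b_seq :: "nat \<Rightarrow> nat" where
  "b_seq n = 3 * 2 ^ n - 1"

definition m_seq :: "nat \<Rightarrow> nat" where
  "m_seq n = 2 ^ n - 1"

definition c_seq :: "nat \<Rightarrow> nat" where
  "c_seq n = 9 * 2 ^ (2 * n - 1) - 1"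

definition r_seq :: "nat \<Rightarrow> nat" where
  "r_seq n = 2 ^ n * a_seq n * b_seq n"

definition s_seq :: "nat \<Rightarrow> nat" where
  "s_seq n = 2 ^ n * c_seq n"

end

theory Submission imports Defs begin

text \<open>
  Summing the divisors \<open>2 ^ i\<close> and \<open>2 ^ i * c_seq n\<close> of \<open>s_seq n\<close> over \<open>i \<le> n\<close> gives
  \<open>(2 ^ (n + 1) - 1) * (c_seq n + 1)\<close>, which equals \<open>r_seq n + s_seq n\<close>. If \<open>c_seq n\<close> has a
  nontrivial divisor, then \<open>s_seq n\<close> has still more divisors, so \<open>aliquot_sum (s_seq n)\<close>
  exceeds \<open>r_seq n\<close>.
\<close>

lemma aliquot_sum_add_self:
  assumes "0 < k"
  shows "aliquot_sum k + k = (\<Sum>d | d dvd k. d)"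
proof -
  have "{d. d dvd k} = insert k {d. d dvd k \<and> d < k}"
    using assms by (auto dest: dvd_imp_le)
  then show ?thesis
    using assms by (simp add: aliquot_sum_def)
qed

text \<open>Otherwise cancelling \<open>2 ^ i\<close> would leave \<open>x\<close> with a factor 2.
  Used in both directions, this forces equal exponents.\<close>

lemma power_two_times_odd_eq_le:
  fixes x y :: nat
  assumes "2 ^ i * x = 2 ^ j * y" "odd x"
  shows "j \<le> i"
proof (rule ccontr)
  assume "\<not> j \<le> i"
  then obtain k where "j = i + Suc k"
    using less_imp_Suc_add by fastforce
  with assms have "x = 2 ^ Suc k * y"
    by (simp add: power_add)
  with assms(2) show False by simp
qed

lemma inj_on_power_two_times_odd:
  fixes E :: "nat set"
  assumes "\<And>x. x \<in> E \<Longrightarrow> odd x"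
  shows "inj_on (\<lambda>(i, x). 2 ^ i * x) (I \<times> E)"
proof (rule inj_onI, clarsimp)
  fix i j x y
  assume "x \<in> E" "y \<in> E" and eq: "2 ^ i * x = 2 ^ j * y"
  then have "i = j"
    using power_two_times_odd_eq_le[of i x j y] power_two_times_odd_eq_le[of j y i x] assms
    by simp
  with eq show "i = j \<and> x = y" by simp
qed

text \<open>The products \<open>2 ^ i * x\<close> with \<open>i \<le> n\<close> and
  \<open>x \<in> E\<close> are pairwise distinct divisors. Leaving \<open>E\<close> free allows a
  lower bound from a few known divisors of \<open>c\<close>.\<close>

lemma sum_divisors_power_two_times_odd_ge:
  fixes c :: nat
  assumes "odd c" "E \<subseteq> {d. d dvd c}"
  shows "(2 ^ Suc n - 1) * \<Sum>E \<le> (\<Sum>d | d dvd 2 ^ n * c. d)"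
proof -
  let ?f = "\<lambda>(i, x). 2 ^ i * x :: nat"
  have pos: "0 < c" using assms(1) by (rule odd_pos)
  have "odd x" if "x \<in> E" for x
    using that assms by (auto intro: dvd_trans)
  then have inj: "inj_on ?f ({..n} \<times> E)"
    by (rule inj_on_power_two_times_odd)
  have "(2 ^ Suc n - 1) * \<Sum>E = (\<Sum>i\<le>n. 2 ^ i) * \<Sum>E"
    by (simp only: sum_power2[symmetric] atLeast0LessThan lessThan_Suc_atMost)
  also have "\<dots> = (\<Sum>p\<in>{..n} \<times> E. ?f p)"
    by (simp add: sum_product sum.cartesian_product)
  also have "\<dots> = \<Sum>(?f ` ({..n} \<times> E))"
    using inj by (simp add: sum.reindex)
  also have "\<dots> \<le> (\<Sum>d | d dvd 2 ^ n * c. d)"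
    using assms(2) pos by (intro sum_mono2) (auto intro!: mult_dvd_mono le_imp_power_dvd)
  finally show ?thesis .
qed

text \<open>Writing a, b, c for the terms at \<open>n\<close>, both (a + 1)(b + 1) and 2^n (a + b +
  2) equal c + 1.\<close>

lemma r_seq_add_s_seq:
  assumes "1 \<le> n"
  shows "r_seq n + s_seq n = (2 ^ Suc n - 1) * (c_seq n + 1)"
proof -
  obtain k where n: "n = Suc k" using assms by (cases n) auto
  \<comment> \<open>In terms of \<open>q\<close> the truncated subtractions vanish
    (\<open>a_seq n\<close> is \<open>3 * q + 2\<close>), leaving a polynomial identity.\<close>
  obtain q :: nat where "2 ^ k = Suc q" by (metis not0_implies_Suc power_not_zero zero_neq_numeral)
  then show ?thesis
    by (simp add: n r_seq_def s_seq_def a_seq_def b_seq_def c_seq_def power_add power_mult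
        power2_eq_square algebra_simps)
qed

theorem lemma1:
  fixes n :: nat
  assumes "n \<ge> 1"
    and "prime (a_seq n)" and "prime (b_seq n)" and "prime (m_seq n)"
    and "\<not> prime (c_seq n)"
  shows "\<not> amicable (r_seq n) (s_seq n)"
proof
  assume am: "amicable (r_seq n) (s_seq n)"
  obtain k where n: "n = Suc k" using assms(1) by (cases n) auto
  have "odd (c_seq n)"
    by (simp add: c_seq_def n)
  \<comment> \<open>Excludes 1, so that failing to be prime yields a nontrivial divisor.\<close>
  have "1 < c_seq n"
    using one_le_power[of "2::nat" "2 * n - 1"] by (simp only: c_seq_def) linarith
  with assms(5) obtain d where d: "d dvd c_seq n" "d \<noteq> 1" "d \<noteq> c_seq n"
    by (auto simp: prime_nat_iff)
  have "0 < d" using d(1) \<open>1 < c_seq n\<close> by (auto intro: Nat.gr0I)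
  have "r_seq n + s_seq n < (2 ^ Suc n - 1) * (1 + (d + c_seq n))"
    using \<open>0 < d\<close> one_less_power[of "2::nat" "Suc n"]
    unfolding r_seq_add_s_seq[OF assms(1)] by (intro mult_strict_left_mono) auto
  \<comment> \<open>The three elements are distinct, so none is lost in the set.\<close>
  also have "\<dots> = (2 ^ Suc n - 1) * \<Sum>{1, d, c_seq n}"
    using d \<open>1 < c_seq n\<close> by simp
  also have "\<dots> \<le> (\<Sum>d | d dvd s_seq n. d)"
    unfolding s_seq_def using \<open>odd (c_seq n)\<close> d(1)
    by (intro sum_divisors_power_two_times_odd_ge) auto
  also have "\<dots> = r_seq n + s_seq n"
    using am aliquot_sum_add_self[of "s_seq n"] by (simp add: amicable_def)
  finally show False by simp
qed

end
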